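(* Let $\omega\ge1$ be an integer, and let $$c_\omega^-:=\max_{\substack{n\in\mathbb{N}\\1\le n\le\omega-1}}\frac{n^2(\omega^2-n^2)}{\omega^2(4\omega^2-3n^2)},\qquad c_\omega^+:=\min_{\substack{n\in\mathbb{N}\\ n>2\omega/\sqrt3}}\frac{n^2(\omega^2-n^2)}{\omega^2(4\omega^2-3n^2)},$$ with the convention $c_1^-:=-\infty$. Let $c\in\mathbb{R}$. Then $\hat\lambda_{c,\omega}>0$ holds if and only if $c_\omega^-<c<c_\omega^+$. In addition, $\hat\lambda_{c,\omega}<0$ holds if and only if either $c<c_\omega^-$ or $c>c_\omega^+$. Furthermore, $c_1^+=\frac32$, and for all $\omega\ge2$, $$0<c_\omega^-<\frac19,\qquad 1<c_\omega^+,$$ and $$\sup_{\omega\ge2}c_\omega^-=\frac19,\qquad \inf_{\omega\ge2}c_\omega^+=1.$$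
   Context: For $c\in\mathbb{R}$ and an integer $\omega\ge1$, $$p_c(x):=2x^4-(6c+2)x^2+8c,\qquad \hat\lambda_{c,\omega}:=\min_{n\in\mathbb{Z}\setminus\{0,\pm\omega\}}p_c\left(\frac n\omega\right)\in\mathbb{R}.$$ *)

theory Defs
  imports Complex_Main "HOL-Library.Extended_Real"
begin

definition p :: "real \<Rightarrow> real \<Rightarrow> real" where
  "p c x = 2 * x ^ 4 - (6 * c + 2) * x\<^sup>2 + 8 * c"

(* The minimum is taken over an infinite set, hence the use of LEAST instead of Min. It is attained
   because p c x tends to infinity as \<bar>x\<bar> does. *)
definition lambda_hat :: "real \<Rightarrow> nat \<Rightarrow> real" where
  "lambda_hat c \<omega> =
     (LEAST y. y \<in> (\<lambda>n::int. p c (real_of_int n / real \<omega>)) ` (UNIV - {0, int \<omega>, - int \<omega>}))"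

definition ratio :: "nat \<Rightarrow> nat \<Rightarrow> real" where
  "ratio \<omega> n =
     (real n)\<^sup>2 * ((real \<omega>)\<^sup>2 - (real n)\<^sup>2) / ((real \<omega>)\<^sup>2 * (4 * (real \<omega>)\<^sup>2 - 3 * (real n)\<^sup>2))"

(* Extended-real valued because of the convention for \<omega> = 1. *)
definition c_minus :: "nat \<Rightarrow> ereal" where
  "c_minus \<omega> = (if \<omega> = 1 then - \<infinity> else ereal (Max (ratio \<omega> ` {1..\<omega> - 1})))"

(* Again a minimum over an infinite set; it is attained because ratio \<omega> n tends to infinity with n.
   The denominator never vanishes, since sqrt 3 is irrational. *)
definition c_plus :: "nat \<Rightarrow> real" where
  "c_plus \<omega> = (LEAST y. y \<in> ratio \<omega> ` {n. real n > 2 * real \<omega> / sqrt 3})"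

end

(* With t = (n/\<omega>)^2 and q t = t (1 - t) / (4 - 3 t), which is the n-th ratio, one has
   p c (n/\<omega>) = 2 (4 - 3 t) (c - q t). So the sign of the minimum is decided by comparing c with
   the values q t: from above for t < 4/3, from below for t > 4/3. The values with 1 < t < 4/3 are
   negative and hence irrelevant once \<omega> \<ge> 2, and no such t exists for \<omega> = 1. Finally
   1/9 - q t = (3 t - 2)^2 / (9 (4 - 3 t)) and q t - 1 = (t - 2)^2 / (3 t - 4), so the extremal
   values belong to the irrational x = sqrt (2/3) and x = sqrt 2: they are approached, but not
   attained, by rational points. *)

theory Submission
  imports Defs
begin

section \<open>Least values of functions with finite sublevel sets\<close>

text \<open>On the reals \<open>LEAST\<close> is a definite description and says nothing until a
  minimum is known to exist. Any minimiser over the finite sublevel set of one sample value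
  \<open>f a0\<close> is a global one, since outside that set the values exceed
  \<open>f a0\<close>.\<close>

lemma LEAST_image_attained:
  fixes f :: "'a \<Rightarrow> real"
  assumes "A \<noteq> {}" and fin: "\<And>B. finite {a \<in> A. f a \<le> B}"
  obtains a where "a \<in> A" "(LEAST y. y \<in> f ` A) = f a" "\<And>b. b \<in> A \<Longrightarrow> f a \<le> f b"
proof -
  obtain a0 where a0: "a0 \<in> A" using assms(1) by blast
  define S where "S = {a \<in> A. f a \<le> f a0}"
  have "finite S" "S \<noteq> {}" using fin a0 by (auto simp: S_def)
  then obtain a where a: "a \<in> S" "\<And>b. b \<in> S \<Longrightarrow> f a \<le> f b"
    using arg_min_if_finite[of S f] by (metis not_le_imp_less)
  have min: "f a \<le> f b" if "b \<in> A" for b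
    using a that by (cases "f b \<le> f a0") (auto simp: S_def)
  have "(LEAST y. y \<in> f ` A) = f a"
    using a(1) min by (intro Least_equality) (auto simp: S_def)
  with that a(1) min show thesis by (auto simp: S_def)
qed

text \<open>Turns strict comparisons with a minimum into quantified ones. Attainment is what makes
  the first equivalence work: for a mere infimum, values above \<open>c\<close> would only give a
  weak inequality.\<close>

lemma attained_min_iff:
  fixes f :: "'a \<Rightarrow> real"
  assumes "P a" "v = f a" "\<And>b. P b \<Longrightarrow> v \<le> f b"
  shows "c < v \<longleftrightarrow> (\<forall>b. P b \<longrightarrow> c < f b)" "v < c \<longleftrightarrow> (\<exists>b. P b \<and> f b < c)"
proof -
  show "c < v \<longleftrightarrow> (\<forall>b. P b \<longrightarrow> c < f b)"
    using assms(1,2) less_le_trans[OF _ assms(3)] by blast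
  show "v < c \<longleftrightarrow> (\<exists>b. P b \<and> f b < c)"
    using assms(1,2) le_less_trans[OF assms(3)] by blast
qed

section \<open>The quotient as a function of the squared frequency\<close>

definition q :: "real \<Rightarrow> real" where
  "q t = t * (1 - t) / (4 - 3 * t)"

lemma ratio_eq_q:
  assumes "\<omega> \<ge> 1"
  shows "ratio \<omega> n = q ((real n / real \<omega>)\<^sup>2)"
proof -
  define w x where "w = (real \<omega>)\<^sup>2" and "x = (real n)\<^sup>2"
  have w: "w > 0" using assms by (simp add: w_def)
  have "q (x / w) = (w * w) * (x / w * (1 - x / w)) / ((w * w) * (4 - 3 * (x / w)))"
    using w by (simp add: q_def)
  also have "(w * w) * (x / w * (1 - x / w)) = x * (w - x)"
    using w by (simp add: field_simps)
  also have "(w * w) * (4 - 3 * (x / w)) = w * (4 * w - 3 * x)"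
    using w by (simp add: field_simps)
  finally show ?thesis
    by (simp add: ratio_def w_def x_def power_divide)
qed

text \<open>For fixed \<open>x\<close> the polynomial is affine in \<open>c\<close> with slope 2 (4
  - 3 x^2), and its root is \<open>q (x\<^sup>2)\<close>. When 3 x^2 = 4 the slope vanishes and the
  value is the constant 8/9, so that case must be excluded.\<close>

lemma p_eq_q:
  assumes "3 * x\<^sup>2 \<noteq> 4"
  shows "p c x = 2 * (4 - 3 * x\<^sup>2) * (c - q (x\<^sup>2))"
proof -
  have "(4 - 3 * x\<^sup>2) * q (x\<^sup>2) = x\<^sup>2 * (1 - x\<^sup>2)"
    using assms by (simp add: q_def)
  moreover have "p c x = 2 * ((4 - 3 * x\<^sup>2) * c - x\<^sup>2 * (1 - x\<^sup>2))"
    by (simp add: p_def algebra_simps power2_eq_square power4_eq_xxxx)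
  ultimately show ?thesis by (simp add: algebra_simps)
qed

lemma p_sign_low:
  assumes "3 * x\<^sup>2 < 4"
  shows "p c x > 0 \<longleftrightarrow> q (x\<^sup>2) < c" "p c x < 0 \<longleftrightarrow> c < q (x\<^sup>2)"
  using assms by (auto simp: p_eq_q zero_less_mult_iff mult_less_0_iff)

lemma p_sign_high:
  assumes "3 * x\<^sup>2 > 4"
  shows "p c x > 0 \<longleftrightarrow> c < q (x\<^sup>2)" "p c x < 0 \<longleftrightarrow> q (x\<^sup>2) < c"
  using assms by (auto simp: p_eq_q zero_less_mult_iff mult_less_0_iff)

lemma q_pos: "0 < t \<Longrightarrow> t < 1 \<Longrightarrow> 0 < q t"
  by (simp add: q_def)

lemma q_neg: "1 < t \<Longrightarrow> 3 * t < 4 \<Longrightarrow> q t < 0"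
  by (simp add: q_def divide_neg_pos mult_pos_neg)

lemma q_less_ninth:
  assumes "t < 1" "3 * t \<noteq> 2"
  shows "q t < 1 / 9"
proof -
  have "(3 * t - 2)\<^sup>2 > 0" using assms by simp
  then have "9 * (t * (1 - t)) < 4 - 3 * t"
    by (simp add: power2_eq_square algebra_simps)
  with assms show ?thesis by (simp add: q_def divide_simps)
qed

text \<open>Flipping both signs makes numerator and denominator positive beyond the pole 4/3, so
  denominators can be cleared there.\<close>

lemma q_high_eq: "q t = t * (t - 1) / (3 * t - 4)"
proof -
  have "q t = - (t * (1 - t)) / - (4 - 3 * t)" by (simp only: q_def minus_divide_left[symmetric] minus_divide_right[symmetric] minus_minus)
  then show ?thesis by (simp add: algebra_simps)
qed

lemma q_greater_1:
  assumes "3 * t > 4" "t \<noteq> 2"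
  shows "q t > 1"
proof -
  have "(t - 2)\<^sup>2 > 0" using assms by simp
  then have "t * (t - 1) > 3 * t - 4"
    by (simp add: power2_eq_square algebra_simps)
  with assms show ?thesis by (simp add: q_high_eq divide_simps)
qed

text \<open>Supplies the growth that makes the sublevel sets in \<open>c_plus_attained\<close>
  finite. After clearing denominators the two sides differ by exactly \<open>t\<close>.\<close>

lemma q_ge_third:
  assumes "3 * t > 4"
  shows "q t \<ge> t / 3"
proof -
  have "t * (3 * t - 4) \<le> 3 * (t * (t - 1))"
    using assms by (simp add: algebra_simps)
  with assms show ?thesis by (simp add: q_high_eq divide_simps mult.commute)
qed

section \<open>Irrational frequencies\<close>

text \<open>A natural number that is the square of a rational is a perfect square, because
  divisibility of squares descends to their bases.\<close>

lemma square_factor: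
  fixes m k w :: nat
  assumes "m\<^sup>2 = k * w\<^sup>2" "w > 0"
  obtains j where "k = j\<^sup>2"
proof -
  have "w\<^sup>2 dvd m\<^sup>2" using assms by simp
  then have "w dvd m" by simp
  then obtain j where "m = w * j" by blast
  with assms have "k = j\<^sup>2" by (simp add: power_mult_distrib)
  with that show thesis .
qed

lemma small_nonsquares:
  fixes j :: nat
  shows "j\<^sup>2 \<noteq> 2" "j\<^sup>2 \<noteq> 3" "j\<^sup>2 \<noteq> 6"
proof -
  have "j = 0 \<or> j = 1 \<or> j = 2 \<or> 3\<^sup>2 \<le> j\<^sup>2"
    using power_mono[of 3 j 2] by linarith
  then show "j\<^sup>2 \<noteq> 2" "j\<^sup>2 \<noteq> 3" "j\<^sup>2 \<noteq> 6" by auto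
qed

text \<open>The excluded values of t are the two equality cases 2 and 2/3 of the bounds on
  \<open>q\<close>, and its pole 4/3.\<close>

lemma rational_square_neq:
  fixes n \<omega> :: nat
  assumes "\<omega> \<ge> 1"
  shows "(real n / real \<omega>)\<^sup>2 \<noteq> 2" "3 * (real n / real \<omega>)\<^sup>2 \<noteq> 4" "3 * (real n / real \<omega>)\<^sup>2 \<noteq> 2"
proof -
  have w: "\<omega> > 0" using assms by simp
  show "(real n / real \<omega>)\<^sup>2 \<noteq> 2"
  proof
    assume "(real n / real \<omega>)\<^sup>2 = 2"
    then have "real (n\<^sup>2) = real (2 * \<omega>\<^sup>2)" using w by (simp add: power_divide field_simps)
    then have "n\<^sup>2 = 2 * \<omega>\<^sup>2" using of_nat_eq_iff by blast
    with w show False by (metis square_factor small_nonsquares(1))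
  qed
  show "3 * (real n / real \<omega>)\<^sup>2 \<noteq> 4"
  proof
    assume "3 * (real n / real \<omega>)\<^sup>2 = 4"
    \<comment> \<open>Multiplying 3 n^2 = 4 \<omega>^2 by 3 produces the shape required by
      \<open>square_factor\<close>, with the nonsquare 3; the next case likewise leads to 6.\<close>
    then have "real ((3 * n)\<^sup>2) = real (3 * (2 * \<omega>)\<^sup>2)" using w
      by (simp add: power_divide power_mult_distrib field_simps)
    then have "(3 * n)\<^sup>2 = 3 * (2 * \<omega>)\<^sup>2" using of_nat_eq_iff by blast
    with w show False by (metis square_factor small_nonsquares(2) nat_0_less_mult_iff zero_less_numeral)
  qed
  show "3 * (real n / real \<omega>)\<^sup>2 \<noteq> 2"
  proof
    assume "3 * (real n / real \<omega>)\<^sup>2 = 2"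
    then have "real ((3 * n)\<^sup>2) = real (6 * \<omega>\<^sup>2)" using w
      by (simp add: power_divide power_mult_distrib field_simps)
    then have "(3 * n)\<^sup>2 = 6 * \<omega>\<^sup>2" using of_nat_eq_iff by blast
    with w show False by (metis square_factor small_nonsquares(3))
  qed
qed

lemma high_iff:
  assumes "\<omega> \<ge> 1"
  shows "real n > 2 * real \<omega> / sqrt 3 \<longleftrightarrow> 3 * (real n / real \<omega>)\<^sup>2 > 4"
proof -
  have "real n > 2 * real \<omega> / sqrt 3 \<longleftrightarrow> 2 / sqrt 3 < real n / real \<omega>"
    using assms by (simp add: field_simps)
  also have "\<dots> \<longleftrightarrow> (2 / sqrt 3)\<^sup>2 < (real n / real \<omega>)\<^sup>2"
    using power_strict_mono[of "2 / sqrt 3" "real n / real \<omega>" 2]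
      power_less_imp_less_base[of "2 / sqrt 3" 2 "real n / real \<omega>"] by auto
  also have "\<dots> \<longleftrightarrow> 3 * (real n / real \<omega>)\<^sup>2 > 4"
    by (simp add: power_divide) argo
  finally show ?thesis .
qed

section \<open>Attained extrema\<close>

lemma c_plus_attained:
  assumes "\<omega> \<ge> 1"
  obtains n where "3 * (real n / real \<omega>)\<^sup>2 > 4" "c_plus \<omega> = q ((real n / real \<omega>)\<^sup>2)"
    "\<And>m. 3 * (real m / real \<omega>)\<^sup>2 > 4 \<Longrightarrow> c_plus \<omega> \<le> q ((real m / real \<omega>)\<^sup>2)"
proof -
  define A where "A = {n. real n > 2 * real \<omega> / sqrt 3}"
  have A: "n \<in> A \<longleftrightarrow> 3 * (real n / real \<omega>)\<^sup>2 > 4" for n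
    using high_iff[OF assms] by (simp add: A_def)
  \<comment> \<open>The frequency 2, with t = 4, is admissible for every \<omega>.\<close>
  have "2 * \<omega> \<in> A" using assms by (simp add: A)
  then have "A \<noteq> {}" by blast
  moreover have "finite {n \<in> A. ratio \<omega> n \<le> B}" for B
  proof (rule finite_subset)
    \<comment> \<open>From t / 3 \<le> \<open>q t\<close> \<le> B one gets n^2 \<le> 3 B \<omega>^2,
      and n \<le> n^2 for natural numbers.\<close>
    show "{n \<in> A. ratio \<omega> n \<le> B} \<subseteq> {.. nat \<lceil>3 * B * (real \<omega>)\<^sup>2\<rceil>}"
    proof
      fix n assume n: "n \<in> {n \<in> A. ratio \<omega> n \<le> B}"
      then have "(real n / real \<omega>)\<^sup>2 / 3 \<le> B"
        using q_ge_third[of "(real n / real \<omega>)\<^sup>2"] assms by (simp add: A ratio_eq_q)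
      then have "(real n)\<^sup>2 \<le> 3 * B * (real \<omega>)\<^sup>2"
        using assms by (simp add: power_divide field_simps)
      moreover have "real n \<le> (real n)\<^sup>2"
        by (cases "n = 0") (simp_all add: self_le_power)
      ultimately have "real n \<le> 3 * B * (real \<omega>)\<^sup>2" by linarith
      then show "n \<in> {.. nat \<lceil>3 * B * (real \<omega>)\<^sup>2\<rceil>}"
        unfolding atMost_iff by linarith
    qed
  qed simp
  ultimately obtain n where "n \<in> A" "(LEAST y. y \<in> ratio \<omega> ` A) = ratio \<omega> n" "\<And>m. m \<in> A \<Longrightarrow> ratio \<omega> n \<le> ratio \<omega> m"
    by (rule LEAST_image_attained) (rule that)
  moreover have "c_plus \<omega> = (LEAST y. y \<in> ratio \<omega> ` A)" by (simp add: c_plus_def A_def)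
  ultimately show thesis using assms by (intro that[of n]) (simp_all add: A ratio_eq_q)
qed

lemma c_plus_compare_iff:
  assumes "\<omega> \<ge> 1"
  shows "c < c_plus \<omega> \<longleftrightarrow> (\<forall>n. 3 * (real n / real \<omega>)\<^sup>2 > 4 \<longrightarrow> c < q ((real n / real \<omega>)\<^sup>2))"
    and "c_plus \<omega> < c \<longleftrightarrow> (\<exists>n. 3 * (real n / real \<omega>)\<^sup>2 > 4 \<and> q ((real n / real \<omega>)\<^sup>2) < c)"
proof -
  obtain n where n: "3 * (real n / real \<omega>)\<^sup>2 > 4" "c_plus \<omega> = q ((real n / real \<omega>)\<^sup>2)"
    "\<And>m. 3 * (real m / real \<omega>)\<^sup>2 > 4 \<Longrightarrow> c_plus \<omega> \<le> q ((real m / real \<omega>)\<^sup>2)"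
    by (rule c_plus_attained[OF assms]) (rule that)
  note iff = attained_min_iff[where P = "\<lambda>n. 3 * (real n / real \<omega>)\<^sup>2 > 4"
      and f = "\<lambda>n. q ((real n / real \<omega>)\<^sup>2)", OF n]
  show "c < c_plus \<omega> \<longleftrightarrow> (\<forall>n. 3 * (real n / real \<omega>)\<^sup>2 > 4 \<longrightarrow> c < q ((real n / real \<omega>)\<^sup>2))"
    by (rule iff)
  show "c_plus \<omega> < c \<longleftrightarrow> (\<exists>n. 3 * (real n / real \<omega>)\<^sup>2 > 4 \<and> q ((real n / real \<omega>)\<^sup>2) < c)"
    by (rule iff)
qed

text \<open>For \<omega> = 1 the index range is empty, and the value minus infinity is exactly what
  keeps both equivalences true: the universal side holds vacuously and the existential side
  fails.\<close>

lemma c_minus_compare_iff: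
  assumes "\<omega> \<ge> 1"
  shows "c_minus \<omega> < ereal c \<longleftrightarrow> (\<forall>n. 1 \<le> n \<and> n < \<omega> \<longrightarrow> q ((real n / real \<omega>)\<^sup>2) < c)"
    and "ereal c < c_minus \<omega> \<longleftrightarrow> (\<exists>n. 1 \<le> n \<and> n < \<omega> \<and> c < q ((real n / real \<omega>)\<^sup>2))"
proof -
  have *: "{1..\<omega> - 1} = {n. 1 \<le> n \<and> n < \<omega>}" using assms by auto
  show "c_minus \<omega> < ereal c \<longleftrightarrow> (\<forall>n. 1 \<le> n \<and> n < \<omega> \<longrightarrow> q ((real n / real \<omega>)\<^sup>2) < c)"
  proof (cases "\<omega> = 1")
    case False
    then have "{1..\<omega> - 1} \<noteq> {}" using assms by simp
    then have "c_minus \<omega> < ereal c \<longleftrightarrow> (\<forall>n\<in>{1..\<omega> - 1}. ratio \<omega> n < c)"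
      using False by (simp add: c_minus_def)
    also have "\<dots> \<longleftrightarrow> (\<forall>n. 1 \<le> n \<and> n < \<omega> \<longrightarrow> q ((real n / real \<omega>)\<^sup>2) < c)"
      unfolding * using assms by (simp add: ratio_eq_q)
    finally show ?thesis .
  qed (simp add: c_minus_def)
  show "ereal c < c_minus \<omega> \<longleftrightarrow> (\<exists>n. 1 \<le> n \<and> n < \<omega> \<and> c < q ((real n / real \<omega>)\<^sup>2))"
  proof (cases "\<omega> = 1")
    case False
    then have "{1..\<omega> - 1} \<noteq> {}" using assms by simp
    then have "ereal c < c_minus \<omega> \<longleftrightarrow> (\<exists>n\<in>{1..\<omega> - 1}. c < ratio \<omega> n)"
      using False by (simp add: c_minus_def Max_gr_iff)
    also have "\<dots> \<longleftrightarrow> (\<exists>n. 1 \<le> n \<and> n < \<omega> \<and> c < q ((real n / real \<omega>)\<^sup>2))"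
      unfolding * using assms by (auto simp: ratio_eq_q)
    finally show ?thesis .
  qed (auto simp: c_minus_def)
qed

text \<open>Besides attainment, this passes from integer to positive natural indices, which is
  possible because \<open>p c\<close> is even.\<close>

lemma lambda_hat_attained:
  assumes "\<omega> \<ge> 1"
  obtains n where "1 \<le> n" "n \<noteq> \<omega>" "lambda_hat c \<omega> = p c (real n / real \<omega>)"
    "\<And>m. 1 \<le> m \<Longrightarrow> m \<noteq> \<omega> \<Longrightarrow> lambda_hat c \<omega> \<le> p c (real m / real \<omega>)"
proof -
  define A where "A = UNIV - {0, int \<omega>, - int \<omega>}"
  define f where "f = (\<lambda>n::int. p c (real_of_int n / real \<omega>))"
  have "2 * int \<omega> \<in> A" using assms by (simp add: A_def)
  then have "A \<noteq> {}" by blast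
  moreover have "finite {n \<in> A. f n \<le> B}" for B
  proof -
    \<comment> \<open>With t = (n/\<omega>)^2, either t < 3 c + 2, or t - (3 c + 1) \<ge> 1 and then
      2 t + 8 c \<le> \<open>f n\<close> \<le> B. The maximum covers both cases, and the factor
      \<omega>^2 converts the bound on t into one on n^2.\<close>
    define M where "M = max (3 * c + 2) ((B - 8 * c) / 2) * (real \<omega>)\<^sup>2"
    have "{n \<in> A. f n \<le> B} \<subseteq> {- \<lceil>M\<rceil>..\<lceil>M\<rceil>}"
    proof
      fix n assume n: "n \<in> {n \<in> A. f n \<le> B}"
      define t where "t = (real_of_int n / real \<omega>)\<^sup>2"
      have "f n = 2 * (t * (t - (3 * c + 1))) + 8 * c"
        by (simp add: f_def p_def t_def algebra_simps power2_eq_square power4_eq_xxxx)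
      moreover have "t * 1 \<le> t * (t - (3 * c + 1))" if "t \<ge> 3 * c + 2"
        using that by (intro mult_left_mono) (auto simp: t_def)
      ultimately have "t \<le> max (3 * c + 2) ((B - 8 * c) / 2)"
        using n by (cases "t \<ge> 3 * c + 2") auto
      then have "t * (real \<omega>)\<^sup>2 \<le> M"
        unfolding M_def by (rule mult_right_mono) simp
      then have "(real_of_int n)\<^sup>2 \<le> M"
        using assms by (simp add: t_def power_divide)
      moreover have "\<bar>real_of_int n\<bar> \<le> (real_of_int n)\<^sup>2"
      proof (cases "n = 0")
        case False
        then have "1 \<le> \<bar>real_of_int n\<bar>" by linarith
        then show ?thesis using self_le_power[of "\<bar>real_of_int n\<bar>" 2] by simp
      qed simp
      ultimately have "\<bar>real_of_int n\<bar> \<le> M" by simp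
      then show "n \<in> {- \<lceil>M\<rceil>..\<lceil>M\<rceil>}" by simp linarith
    qed
    then show ?thesis by (rule finite_subset) simp
  qed
  ultimately obtain n where n: "n \<in> A" "(LEAST y. y \<in> f ` A) = f n" "\<And>m. m \<in> A \<Longrightarrow> f n \<le> f m"
    by (rule LEAST_image_attained) (rule that)
  then have "lambda_hat c \<omega> = f n" by (simp add: lambda_hat_def A_def f_def)
  moreover have "f n = p c (real (nat \<bar>n\<bar>) / real \<omega>)"
    by (simp add: f_def p_def power_divide)
  moreover have "n \<noteq> 0" "n \<noteq> int \<omega>" "n \<noteq> - int \<omega>" using n(1) by (simp_all add: A_def)
  then have "nat \<bar>n\<bar> \<ge> 1" "nat \<bar>n\<bar> \<noteq> \<omega>" by arith+
  moreover have "f n \<le> p c (real m / real \<omega>)" if "1 \<le> m" "m \<noteq> \<omega>" for m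
    using n(3)[of "int m"] that by (simp add: A_def f_def)
  ultimately show thesis by (intro that[of "nat \<bar>n\<bar>"]) simp_all
qed

lemma lambda_hat_sign_iff:
  assumes "\<omega> \<ge> 1"
  shows "lambda_hat c \<omega> > 0 \<longleftrightarrow> (\<forall>n. 1 \<le> n \<and> n \<noteq> \<omega> \<longrightarrow> p c (real n / real \<omega>) > 0)"
    and "lambda_hat c \<omega> < 0 \<longleftrightarrow> (\<exists>n. 1 \<le> n \<and> n \<noteq> \<omega> \<and> p c (real n / real \<omega>) < 0)"
proof -
  obtain n where n: "1 \<le> n \<and> n \<noteq> \<omega>" "lambda_hat c \<omega> = p c (real n / real \<omega>)"
    "\<And>m. 1 \<le> m \<and> m \<noteq> \<omega> \<Longrightarrow> lambda_hat c \<omega> \<le> p c (real m / real \<omega>)"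
    by (rule lambda_hat_attained[OF assms]) blast
  note iff = attained_min_iff[where P = "\<lambda>n. 1 \<le> n \<and> n \<noteq> \<omega>" and f = "\<lambda>n. p c (real n / real \<omega>)", OF n]
  show "lambda_hat c \<omega> > 0 \<longleftrightarrow> (\<forall>n. 1 \<le> n \<and> n \<noteq> \<omega> \<longrightarrow> p c (real n / real \<omega>) > 0)"
    by (rule iff)
  show "lambda_hat c \<omega> < 0 \<longleftrightarrow> (\<exists>n. 1 \<le> n \<and> n \<noteq> \<omega> \<and> p c (real n / real \<omega>) < 0)"
    using iff(2)[of 0] by blast
qed

section \<open>The sign of the minimum\<close>

text \<open>One positive value suffices for a maximum: n = 1 gives 0 < t < 1 as soon as \<omega>
  \<ge> 2.\<close>

lemma c_minus_pos:
  assumes "\<omega> \<ge> 2"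
  shows "0 < c_minus \<omega>"
  using c_minus_compare_iff(2)[of \<omega> 0] q_pos[of "(1 / real \<omega>)\<^sup>2"] assms
  by (auto simp: zero_ereal_def power_divide intro!: exI[of _ 1])

text \<open>The band 1 < t < 4/3 enters neither \<open>c_minus\<close> nor \<open>c_plus\<close>.
  This bound shows that the constraint it puts on \<open>c\<close> is implied by the one from
  \<open>c_minus\<close>.\<close>

lemma q_middle_less_c_minus:
  assumes "\<omega> \<ge> 1" "n > \<omega>" "3 * (real n / real \<omega>)\<^sup>2 < 4"
  shows "ereal (q ((real n / real \<omega>)\<^sup>2)) < c_minus \<omega>"
proof -
  have "\<omega> \<noteq> 1"
  proof
    assume "\<omega> = 1"
    \<comment> \<open>For \<omega> = 1, n > 1 forces t \<ge> 4, far beyond the band.\<close>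
    then have "2\<^sup>2 \<le> (real n)\<^sup>2" using assms(2) by (intro power_mono) auto
    with assms(3) \<open>\<omega> = 1\<close> show False by simp
  qed
  then have "0 < c_minus \<omega>" using assms(1) c_minus_pos by simp
  moreover have "1 < (real n / real \<omega>)\<^sup>2" using assms(1,2) by (intro one_less_power) auto
  then have "ereal (q ((real n / real \<omega>)\<^sup>2)) < 0" using q_neg assms(3) by simp
  ultimately show ?thesis by (rule less_trans[rotated])
qed

lemma low_square:
  assumes "n < \<omega>"
  shows "(real n / real \<omega>)\<^sup>2 < 1"
  using assms by (simp add: power_less_one_iff abs_square_less_1)

lemma lambda_hat_pos_iff:
  assumes "\<omega> \<ge> 1"
  shows "lambda_hat c \<omega> > 0 \<longleftrightarrow> c_minus \<omega> < ereal c \<and> c < c_plus \<omega>"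
proof
  assume L: "lambda_hat c \<omega> > 0"
  have pos: "p c (real n / real \<omega>) > 0" if "1 \<le> n" "n \<noteq> \<omega>" for n
    using L lambda_hat_sign_iff(1)[OF assms] that by blast
  have "q ((real n / real \<omega>)\<^sup>2) < c" if "1 \<le> n" "n < \<omega>" for n
    using pos[of n] p_sign_low(1) low_square[of n \<omega>] that by simp
  moreover have "c < q ((real n / real \<omega>)\<^sup>2)" if n: "3 * (real n / real \<omega>)\<^sup>2 > 4" for n
  proof -
    \<comment> \<open>These indices would give t = 0 or t = 1, below 4/3, so no index removed from
      the minimum lies in the upper band.\<close>
    have "n \<noteq> 0" "n \<noteq> \<omega>" using n assms by (auto intro: gr0I)
    then show ?thesis using pos[of n] p_sign_high(1) n by simp
  qed
  ultimately show "c_minus \<omega> < ereal c \<and> c < c_plus \<omega>"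
    using c_minus_compare_iff(1)[OF assms] c_plus_compare_iff(1)[OF assms] by blast
next
  assume R: "c_minus \<omega> < ereal c \<and> c < c_plus \<omega>"
  have "p c (real n / real \<omega>) > 0" if n: "1 \<le> n" "n \<noteq> \<omega>" for n
  proof -
    \<comment> \<open>The three bands are exhaustive because n = \<omega> is removed from the
      minimum and 3 t = 4 is impossible for rational frequencies.\<close>
    consider "n < \<omega>" | "n > \<omega>" "3 * (real n / real \<omega>)\<^sup>2 < 4" | "3 * (real n / real \<omega>)\<^sup>2 > 4"
      using n rational_square_neq(2)[OF assms, of n] by linarith
    then show ?thesis
    proof cases
      case 1
      then show ?thesis
        using R n c_minus_compare_iff(1)[OF assms, of c] p_sign_low(1)[of "real n / real \<omega>" c]
          low_square[OF 1] by auto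
    next
      case 2
      then show ?thesis
        using less_trans[OF q_middle_less_c_minus[OF assms 2] conjunct1[OF R]]
          p_sign_low(1)[of "real n / real \<omega>" c] by simp
    next
      case 3
      then show ?thesis
        using R c_plus_compare_iff(1)[OF assms, of c] p_sign_high(1) by blast
    qed
  qed
  then show "lambda_hat c \<omega> > 0" using lambda_hat_sign_iff(1)[OF assms] by blast
qed

text \<open>This is not the negation of \<open>lambda_hat_pos_iff\<close>: the minimum is zero when
  \<open>c\<close> equals one of the two thresholds. The same bands are therefore searched for a
  frequency with a negative value.\<close>

lemma lambda_hat_neg_iff:
  assumes "\<omega> \<ge> 1"
  shows "lambda_hat c \<omega> < 0 \<longleftrightarrow> ereal c < c_minus \<omega> \<or> c > c_plus \<omega>"
proof
  assume "lambda_hat c \<omega> < 0"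
  then obtain n where n: "1 \<le> n" "n \<noteq> \<omega>" "p c (real n / real \<omega>) < 0"
    using lambda_hat_sign_iff(2)[OF assms] by blast
  consider "n < \<omega>" | "n > \<omega>" "3 * (real n / real \<omega>)\<^sup>2 < 4" | "3 * (real n / real \<omega>)\<^sup>2 > 4"
    using n rational_square_neq(2)[OF assms, of n] by linarith
  then show "ereal c < c_minus \<omega> \<or> c > c_plus \<omega>"
  proof cases
    case 1
    then have "c < q ((real n / real \<omega>)\<^sup>2)"
      using n p_sign_low(2)[of "real n / real \<omega>" c] low_square[OF 1] by simp
    with 1 n(1) show ?thesis using c_minus_compare_iff(2)[OF assms] by blast
  next
    case 2
    then have "ereal c < ereal (q ((real n / real \<omega>)\<^sup>2))"
      using n p_sign_low(2)[of "real n / real \<omega>" c] by simp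
    \<comment> \<open>A negative value in the middle band puts \<open>c\<close> below a value of
      \<open>q\<close> that is itself below \<open>c_minus\<close>.\<close>
    then show ?thesis using q_middle_less_c_minus[OF assms 2] by (meson less_trans)
  next
    case 3
    then show ?thesis
      using n c_plus_compare_iff(2)[OF assms, of c] p_sign_high(2) by blast
  qed
next
  assume "ereal c < c_minus \<omega> \<or> c > c_plus \<omega>"
  then consider n where "1 \<le> n" "n < \<omega>" "c < q ((real n / real \<omega>)\<^sup>2)"
    | n where "3 * (real n / real \<omega>)\<^sup>2 > 4" "q ((real n / real \<omega>)\<^sup>2) < c"
    using c_minus_compare_iff(2)[OF assms] c_plus_compare_iff(2)[OF assms] by blast
  then have "\<exists>n. 1 \<le> n \<and> n \<noteq> \<omega> \<and> p c (real n / real \<omega>) < 0"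
  proof cases
    case (1 n)
    then have "p c (real n / real \<omega>) < 0"
      using p_sign_low(2)[of "real n / real \<omega>" c] low_square[of n \<omega>] by simp
    with 1 show ?thesis by (intro exI[of _ n]) auto
  next
    case (2 n)
    then have "p c (real n / real \<omega>) < 0" using p_sign_high(2) by blast
    moreover have "n \<noteq> 0" "n \<noteq> \<omega>" using 2(1) assms by (auto intro: gr0I)
    ultimately show ?thesis by (intro exI[of _ n]) auto
  qed
  then show "lambda_hat c \<omega> < 0" using lambda_hat_sign_iff(2)[OF assms] by blast
qed

section \<open>Bounds for the extrema and their limits\<close>

lemma c_plus_1: "c_plus 1 = 3 / 2"
proof (rule antisym)
  have "3 * (real 2 / real 1)\<^sup>2 > 4" by simp
  then have "c_plus 1 \<le> q ((real 2 / real 1)\<^sup>2)"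
    using c_plus_attained[of 1] by (metis le_refl)
  then show "c_plus 1 \<le> 3 / 2" by (simp add: q_def)
next
  obtain n where n: "3 * (real n / real 1)\<^sup>2 > 4" "c_plus 1 = q ((real n / real 1)\<^sup>2)"
    using c_plus_attained[of 1] by auto
  have "n \<noteq> 0" "n \<noteq> 1" using n(1) by (auto intro: gr0I)
  then have "2\<^sup>2 \<le> (real n)\<^sup>2" by (intro power_mono) auto
  then have t: "(real n)\<^sup>2 \<ge> 4" by simp
  \<comment> \<open>With t = n^2, the claim t (t - 1) / (3 t - 4) \<ge> 3/2 amounts to 2 t^2 - 11 t
    + 12 \<ge> 0, which factors as shown; the root t = 4 is the minimiser n = 2.\<close>
  then have "0 \<le> (2 * (real n)\<^sup>2 - 3) * ((real n)\<^sup>2 - 4)" by simp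
  then have "3 * (3 * (real n)\<^sup>2 - 4) \<le> 2 * ((real n)\<^sup>2 * ((real n)\<^sup>2 - 1))"
    by (simp add: algebra_simps)
  then show "3 / 2 \<le> c_plus 1"
    using n(2) t by (simp add: q_high_eq pos_le_divide_eq)
qed

text \<open>Strictness survives the maximum because only finitely many values compete, and the
  equality case t = 2/3 is not a rational square.\<close>

lemma c_minus_less_ninth:
  assumes "\<omega> \<ge> 1"
  shows "c_minus \<omega> < ereal (1 / 9)"
  using assms c_minus_compare_iff(1)[OF assms] q_less_ninth low_square rational_square_neq(3) by metis

text \<open>Strictness survives because the minimum is attained, at some t different from the
  irrational equality case t = 2.\<close>

lemma c_plus_greater_1:
  assumes "\<omega> \<ge> 1"
  shows "1 < c_plus \<omega>"
  using assms c_plus_compare_iff(1)[OF assms] q_greater_1 rational_square_neq(1) by metis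

section \<open>Sharpness of the bounds 1/9 and 1 by rational approximation\<close>

lemma rational_approx:
  fixes x :: real
  assumes "x > 0"
  shows "(\<lambda>\<omega>. real (nat \<lfloor>x * real \<omega>\<rfloor>) / real \<omega>) \<longlonglongrightarrow> x"
proof (rule real_tendsto_sandwich)
  show "(\<lambda>\<omega>. x - 1 / real \<omega>) \<longlonglongrightarrow> x"
    using tendsto_diff[OF tendsto_const lim_1_over_n] by simp
  have "x - 1 / real \<omega> \<le> real (nat \<lfloor>x * real \<omega>\<rfloor>) / real \<omega> \<and> real (nat \<lfloor>x * real \<omega>\<rfloor>) / real \<omega> \<le> x"
    if "\<omega> > 0" for \<omega>
  proof -
    have "x * real \<omega> - 1 \<le> real (nat \<lfloor>x * real \<omega>\<rfloor>)" by linarith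
    moreover have "real (nat \<lfloor>x * real \<omega>\<rfloor>) \<le> x * real \<omega>"
      using assms by (intro of_nat_floor) simp
    ultimately have "(x * real \<omega> - 1) / real \<omega> \<le> real (nat \<lfloor>x * real \<omega>\<rfloor>) / real \<omega> \<and>
      real (nat \<lfloor>x * real \<omega>\<rfloor>) / real \<omega> \<le> x * real \<omega> / real \<omega>"
      by (blast intro: divide_right_mono of_nat_0_le_iff)
    then show ?thesis using that by (simp add: diff_divide_distrib)
  qed
  then show "\<forall>\<^sub>F \<omega> in sequentially. x - 1 / real \<omega> \<le> real (nat \<lfloor>x * real \<omega>\<rfloor>) / real \<omega>"
    and "\<forall>\<^sub>F \<omega> in sequentially. real (nat \<lfloor>x * real \<omega>\<rfloor>) / real \<omega> \<le> x"
    by (auto intro: eventually_mono[OF eventually_gt_at_top])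
qed (rule tendsto_const)

text \<open>Uses continuity of \<open>q\<close> away from its pole. The limit of the squared
  frequencies is recorded too, since it shows that the approximating indices are eventually
  admissible.\<close>

lemma q_approx:
  assumes "t > 0" "3 * t \<noteq> 4"
  defines "n \<equiv> \<lambda>\<omega>. nat \<lfloor>sqrt t * real \<omega>\<rfloor>"
  shows "(\<lambda>\<omega>. (real (n \<omega>) / real \<omega>)\<^sup>2) \<longlonglongrightarrow> t"
    and "(\<lambda>\<omega>. q ((real (n \<omega>) / real \<omega>)\<^sup>2)) \<longlonglongrightarrow> q t"
proof -
  show *: "(\<lambda>\<omega>. (real (n \<omega>) / real \<omega>)\<^sup>2) \<longlonglongrightarrow> t"
    using tendsto_power[OF rational_approx[of "sqrt t"], of 2] assms by simp
  show "(\<lambda>\<omega>. q ((real (n \<omega>) / real \<omega>)\<^sup>2)) \<longlonglongrightarrow> q t"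
    unfolding q_def by (intro tendsto_intros *) (use assms in auto)
qed

lemma ex_c_minus_greater:
  assumes "c < 1 / 9"
  shows "\<exists>\<omega>\<ge>2. ereal c < c_minus \<omega>"
proof -
  define n where "n = (\<lambda>\<omega>. nat \<lfloor>sqrt (2 / 3) * real \<omega>\<rfloor>)"
  have lim: "(\<lambda>\<omega>. (real (n \<omega>) / real \<omega>)\<^sup>2) \<longlonglongrightarrow> 2 / 3"
    "(\<lambda>\<omega>. q ((real (n \<omega>) / real \<omega>)\<^sup>2)) \<longlonglongrightarrow> q (2 / 3)"
    using q_approx[of "2 / 3"] by (simp_all add: n_def)
  have "q (2 / 3) = 1 / 9" by (simp add: q_def)
  then have "eventually (\<lambda>\<omega>. c < q ((real (n \<omega>) / real \<omega>)\<^sup>2)) sequentially"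
    using order_tendstoD(1)[OF lim(2)] assms by simp
  \<comment> \<open>The limit 2/3 lies inside (0, 1), so eventually 1 \<le>
    \<open>n \<omega>\<close> < \<omega>, as the maximum in \<open>c_minus\<close> requires.\<close>
  moreover have "eventually (\<lambda>\<omega>. 0 < (real (n \<omega>) / real \<omega>)\<^sup>2) sequentially"
    by (rule order_tendstoD(1)[OF lim(1)]) simp
  moreover have "eventually (\<lambda>\<omega>. (real (n \<omega>) / real \<omega>)\<^sup>2 < 1) sequentially"
    by (rule order_tendstoD(2)[OF lim(1)]) simp
  moreover have "eventually (\<lambda>\<omega>::nat. \<omega> \<ge> 2) sequentially" by (rule eventually_ge_at_top)
  ultimately have "eventually (\<lambda>\<omega>. \<omega> \<ge> 2 \<and> ereal c < c_minus \<omega>) sequentially"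
  proof eventually_elim
    case (elim \<omega>)
    have "n \<omega> \<ge> 1" using elim by (cases "n \<omega>") auto
    moreover have "n \<omega> < \<omega>" using elim by (simp add: abs_square_less_1)
    ultimately show ?case using elim c_minus_compare_iff(2)[of \<omega> c] by auto
  qed
  then show ?thesis using eventually_happens'[OF sequentially_bot] by blast
qed

lemma ex_c_plus_less:
  assumes "c > 1"
  shows "\<exists>\<omega>\<ge>2. c_plus \<omega> < c"
proof -
  define n where "n = (\<lambda>\<omega>. nat \<lfloor>sqrt 2 * real \<omega>\<rfloor>)"
  have lim: "(\<lambda>\<omega>. (real (n \<omega>) / real \<omega>)\<^sup>2) \<longlonglongrightarrow> 2"
    "(\<lambda>\<omega>. q ((real (n \<omega>) / real \<omega>)\<^sup>2)) \<longlonglongrightarrow> q (2)"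
    using q_approx[of "2"] by (simp_all add: n_def)
  have "q 2 = 1" by (simp add: q_def)
  then have "eventually (\<lambda>\<omega>. q ((real (n \<omega>) / real \<omega>)\<^sup>2) < c) sequentially"
    using order_tendstoD(2)[OF lim(2)] assms by simp
  moreover have "eventually (\<lambda>\<omega>. 4 / 3 < (real (n \<omega>) / real \<omega>)\<^sup>2) sequentially"
    by (rule order_tendstoD(1)[OF lim(1)]) simp
  moreover have "eventually (\<lambda>\<omega>::nat. \<omega> \<ge> 2) sequentially" by (rule eventually_ge_at_top)
  ultimately have "eventually (\<lambda>\<omega>. \<omega> \<ge> 2 \<and> c_plus \<omega> < c) sequentially"
  proof eventually_elim
    case (elim \<omega>)
    then have "3 * (real (n \<omega>) / real \<omega>)\<^sup>2 > 4" by linarith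
    with elim show ?case using c_plus_compare_iff(2)[of \<omega> c] by auto
  qed
  then show ?thesis using eventually_happens'[OF sequentially_bot] by blast
qed

lemma SUP_c_minus: "(SUP \<omega>\<in>{2..}. c_minus \<omega>) = ereal (1 / 9)"
proof (rule SUP_eqI)
  show "c_minus \<omega> \<le> ereal (1 / 9)" if "\<omega> \<in> {2..}" for \<omega>
    using c_minus_less_ninth[of \<omega>] that by simp
next
  fix y assume y: "\<And>\<omega>. \<omega> \<in> {2..} \<Longrightarrow> c_minus \<omega> \<le> y"
  show "ereal (1 / 9) \<le> y"
  \<comment> \<open>It suffices to test real upper bounds z of y, since
    \<open>ex_c_minus_greater\<close> speaks of real thresholds.\<close>
  proof (rule ereal_le_real)
    fix z assume "y \<le> ereal z"
    show "ereal (1 / 9) \<le> ereal z"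
    proof (rule ccontr)
      assume "\<not> ereal (1 / 9) \<le> ereal z"
      then obtain \<omega> where "\<omega> \<ge> 2" "ereal z < c_minus \<omega>" using ex_c_minus_greater[of z] by auto
      with y[of \<omega>] \<open>y \<le> ereal z\<close> show False by auto
    qed
  qed
qed

lemma INF_c_plus: "(INF \<omega>\<in>{2..}. c_plus \<omega>) = 1"
proof (rule cInf_eq_non_empty)
  show "1 \<le> x" if "x \<in> c_plus ` {2..}" for x
    using that c_plus_greater_1 by (auto intro: less_imp_le)
next
  fix y assume y: "\<And>x. x \<in> c_plus ` {2..} \<Longrightarrow> y \<le> x"
  show "y \<le> 1"
    using ex_c_plus_less[of y] y by (metis atLeast_iff imageI not_le)
qed simp

theorem proposition3p14:
  shows "(\<forall>\<omega>::nat. \<forall>c::real. \<omega> \<ge> 1 \<longrightarrow>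
            (lambda_hat c \<omega> > 0 \<longleftrightarrow> c_minus \<omega> < ereal c \<and> c < c_plus \<omega>) \<and>
            (lambda_hat c \<omega> < 0 \<longleftrightarrow> ereal c < c_minus \<omega> \<or> c > c_plus \<omega>)) \<and>
         c_plus 1 = 3 / 2 \<and>
         (\<forall>\<omega>::nat. \<omega> \<ge> 2 \<longrightarrow> 0 < c_minus \<omega> \<and> c_minus \<omega> < ereal (1 / 9) \<and> 1 < c_plus \<omega>) \<and>
         (SUP \<omega>\<in>{2..}. c_minus \<omega>) = ereal (1 / 9) \<and>
         (INF \<omega>\<in>{2..}. c_plus \<omega>) = 1"
  using lambda_hat_pos_iff lambda_hat_neg_iff c_plus_1 c_minus_pos c_minus_less_ninth
    c_plus_greater_1 SUP_c_minus INF_c_plus by simp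

end
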